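(* Let $(X,d)$ be a finite nonempty ultrametric space with $|X|=n$ and representing tree $T_X$. Then for any minimum spanning path $P\in\mathfrak{P}_{min}(X)$ with $V(P)=\{x_1,\dots,x_n\}$ (numbered consecutively along $P$) and path spectrum $\mathcal{PS}(P)=(s_1,\dots,s_{n-1})$ the following conditions are equivalent. (i) The labels of different internal nodes of $T_X$ are different. (ii) If $s_i=s_j$, $1\le i<j\le n-1$, then the inequality $s_k\le s_i=s_j$ holds for every $k$ such that $i<k<j$.
   Context: An ultrametric space $(X,d)$ is a metric space with $d(x,y)\le\max\{d(x,z),d(z,y)\}$ for all $x,y,z$. Minimum spanning paths: a finite metric space $(X,d)$ is regarded as the complete weighted graph $(G_X,w)$ with $V(G_X)=X$ and $w(\{x,y\})=d(x,y)$ for $x\ne y$. A minimum spanning tree of $(X,d)$ is a spanning tree of $G_X$ whose sum of edge weights is smallest among all spanning trees. $\mathfrak{P}_{min}(X)$ is the set of all minimum spanning paths, i.e. minimum spanning trees that are paths (a path is a nonempty graph with vertices $x_1,\dots,x_n$ and edges exactly $\{x_1,x_2\},\dots,\{x_{n-1},x_n\}$; a single vertex is allowed). For $P\in\mathfrak{P}_{min}(X)$ with vertices numbered $x_1,\dots,x_n$ along $P$, the path spectrum is $\mathcal{PS}(P)=(s_1,\dots,s_{n-1})$, $s_i=d(x_i,x_{i+1})$. Representing tree: for a finite ultrametric space $X$ with $|X|\ge 2$, the diametrical graph $G_{D,X}$ has vertex set $X$, with $u,v$ adjacent iff $d(u,v)=\operatorname{diam}X$; it is known to be a complete multipartite graph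 with parts $X_1,\dots,X_k$, $k\ge2$ (the parts are the classes of the equivalence relation $d(u,v)<\operatorname{diam}X$). The representing tree $T_X$ is the labeled rooted tree whose nodes are subsets of $X$, constructed as follows: the root is $X$ with label $\operatorname{diam}X$; if $|X|=1$, $T_X$ consists of the root only (a leaf, with label $0$); if $|X|\ge2$, the children of the root are the parts $X_1,\dots,X_k$ of $G_{D,X}$, each labeled $l(X_i)=\operatorname{diam}X_i$; nodes of label $0$ (singletons) are leaves, nodes of positive label are internal nodes, and the construction is repeated at each internal node $X_i$, using the subspace $X_i$ in place of $X$, and so on. *)

theory Defs
  imports "HOL-Analysis.Abstract_Metric_Spaces" "HOL-Library.Disjoint_Sets"
begin

locale Ultrametric_space = Metric_space M d
  for M :: "'a set" and d :: "'a \<Rightarrow> 'a \<Rightarrow> real" +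
  assumes strong_triangle:
    "\<And>x y z. \<lbrakk>x \<in> M; y \<in> M; z \<in> M\<rbrakk> \<Longrightarrow> d x y \<le> max (d x z) (d z y)"

text \<open>The library diameter is tied to the type class of metric spaces; this is its
  counterpart for a distance function on an explicit carrier.\<close>

definition mdiam :: "('a \<Rightarrow> 'a \<Rightarrow> real) \<Rightarrow> 'a set \<Rightarrow> real" where
  "mdiam d A = (if A = {} then 0 else SUP (x, y)\<in>A \<times> A. d x y)"


section \<open>Finite simple graphs, trees and paths\<close>

text \<open>A simple graph is a pair of a vertex set and a set of two-element subsets of it.\<close>

type_synonym 'a sgraph = "'a set \<times> 'a set set"

abbreviation gverts :: "'a sgraph \<Rightarrow> 'a set" where "gverts \<equiv> fst"
abbreviation gedges :: "'a sgraph \<Rightarrow> 'a set set" where "gedges \<equiv> snd"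

definition complete_sgraph :: "'a set \<Rightarrow> 'a sgraph" where
  "complete_sgraph V = (V, {{u, v} | u v. u \<in> V \<and> v \<in> V \<and> u \<noteq> v})"

definition sgraph :: "'a sgraph \<Rightarrow> bool" where
  "sgraph G \<longleftrightarrow> gedges G \<subseteq> gedges (complete_sgraph (gverts G))"

definition sgraph_connected :: "'a sgraph \<Rightarrow> bool" where
  "sgraph_connected G \<longleftrightarrow>
     (\<forall>u\<in>gverts G. \<forall>v\<in>gverts G. (u, v) \<in> {(a, b). {a, b} \<in> gedges G}\<^sup>*)"

definition path_edges :: "'a list \<Rightarrow> 'a set set" where
  "path_edges xs = {{xs ! i, xs ! Suc i} | i. Suc i < length xs}"

definition sgraph_cycle :: "'a sgraph \<Rightarrow> 'a list \<Rightarrow> bool" where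
  "sgraph_cycle G xs \<longleftrightarrow> 3 \<le> length xs \<and> distinct xs \<and> set xs \<subseteq> gverts G \<and>
     path_edges xs \<subseteq> gedges G \<and> {last xs, hd xs} \<in> gedges G"

definition sgraph_tree :: "'a sgraph \<Rightarrow> bool" where
  "sgraph_tree T \<longleftrightarrow> sgraph T \<and> gverts T \<noteq> {} \<and> sgraph_connected T \<and>
     (\<nexists>xs. sgraph_cycle T xs)"

definition sgraph_spanning_tree :: "'a sgraph \<Rightarrow> 'a sgraph \<Rightarrow> bool" where
  "sgraph_spanning_tree T G \<longleftrightarrow>
     sgraph_tree T \<and> gverts T = gverts G \<and> gedges T \<subseteq> gedges G"

definition path_numbering :: "'a sgraph \<Rightarrow> 'a list \<Rightarrow> bool" where
  "path_numbering P xs \<longleftrightarrow>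
     xs \<noteq> [] \<and> distinct xs \<and> gverts P = set xs \<and> gedges P = path_edges xs"

definition sgraph_path :: "'a sgraph \<Rightarrow> bool" where
  "sgraph_path P \<longleftrightarrow> (\<exists>xs. path_numbering P xs)"


section \<open>Minimum spanning trees and paths of a finite metric space\<close>

text \<open>Well defined on two-element sets since \<^term>\<open>d\<close> is symmetric.\<close>

definition edge_weight :: "('a \<Rightarrow> 'a \<Rightarrow> real) \<Rightarrow> 'a set \<Rightarrow> real" where
  "edge_weight d e = (THE r. \<exists>x y. x \<noteq> y \<and> e = {x, y} \<and> r = d x y)"

lemma (in Metric_space) edge_weight_doubleton:
  "x \<noteq> y \<Longrightarrow> edge_weight d {x, y} = d x y"
  unfolding edge_weight_def using commute[of x y]
  by (intro the_equality) (blast, force simp: doubleton_eq_iff)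

definition total_weight :: "('a \<Rightarrow> 'a \<Rightarrow> real) \<Rightarrow> 'a sgraph \<Rightarrow> real" where
  "total_weight d G = (\<Sum>e\<in>gedges G. edge_weight d e)"

definition min_spanning_trees :: "'a set \<Rightarrow> ('a \<Rightarrow> 'a \<Rightarrow> real) \<Rightarrow> 'a sgraph set" where
  "min_spanning_trees X d =
     {T. sgraph_spanning_tree T (complete_sgraph X) \<and>
         (\<forall>T'. sgraph_spanning_tree T' (complete_sgraph X) \<longrightarrow>
               total_weight d T \<le> total_weight d T')}"

definition min_spanning_paths :: "'a set \<Rightarrow> ('a \<Rightarrow> 'a \<Rightarrow> real) \<Rightarrow> 'a sgraph set" where
  "min_spanning_paths X d = {P \<in> min_spanning_trees X d. sgraph_path P}"

text \<open>The spectrum depends on the direction in which the path is numbered, so it takes the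
  numbering; list positions start at 0.\<close>

definition path_spectrum :: "('a \<Rightarrow> 'a \<Rightarrow> real) \<Rightarrow> 'a list \<Rightarrow> real list" where
  "path_spectrum d xs = map (\<lambda>i. d (xs ! i) (xs ! Suc i)) [0..<length xs - 1]"


section \<open>The representing tree\<close>

definition diametrical_graph :: "('a \<Rightarrow> 'a \<Rightarrow> real) \<Rightarrow> 'a set \<Rightarrow> 'a sgraph" where
  "diametrical_graph d A = (A, {{u, v} | u v. u \<in> A \<and> v \<in> A \<and> u \<noteq> v \<and> d u v = mdiam d A})"

definition complete_multipartite :: "'a sgraph \<Rightarrow> 'a set set \<Rightarrow> bool" where
  "complete_multipartite G Ps \<longleftrightarrow> partition_on (gverts G) Ps \<and> 2 \<le> card Ps \<and>
     gedges G = {{u, v} | u v. \<exists>B\<in>Ps. \<exists>C\<in>Ps. B \<noteq> C \<and> u \<in> B \<and> v \<in> C}"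

record ('v, 'l) labeled_rooted_tree =
  tree_root :: 'v
  tree_nodes :: "'v set"
  tree_children :: "'v \<Rightarrow> 'v set"
  tree_label :: "'v \<Rightarrow> 'l"

text \<open>The partition into parts is unique, and exists when \<^term>\<open>A\<close> is a finite ultrametric
  space with at least two points; see the lemma below.\<close>

definition node_children :: "('a \<Rightarrow> 'a \<Rightarrow> real) \<Rightarrow> 'a set \<Rightarrow> 'a set set" where
  "node_children d A =
     {B. 2 \<le> card A \<and> (\<exists>Ps. complete_multipartite (diametrical_graph d A) Ps \<and> B \<in> Ps)}"

definition representing_tree ::
    "'a set \<Rightarrow> ('a \<Rightarrow> 'a \<Rightarrow> real) \<Rightarrow> ('a set, real) labeled_rooted_tree" where
  "representing_tree X d =
     \<lparr> tree_root = X,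
       tree_nodes = {B. (X, B) \<in> {(A, B). B \<in> node_children d A}\<^sup>*},
       tree_children = node_children d,
       tree_label = mdiam d \<rparr>"

definition internal_nodes :: "('v, real) labeled_rooted_tree \<Rightarrow> 'v set" where
  "internal_nodes T = {v \<in> tree_nodes T. 0 < tree_label T v}"


section \<open>Existence and uniqueness of the parts\<close>

lemma mdiam_eq_Max:
  assumes "finite A" "A \<noteq> {}"
  shows "mdiam d A = Max ((\<lambda>(x, y). d x y) ` (A \<times> A))"
  using assms unfolding mdiam_def by (simp add: cSup_eq_Max)

lemma multipartite_parts_unique:
  assumes "complete_multipartite G Ps"
  shows "Ps = gverts G // {(u, v). u \<in> gverts G \<and> v \<in> gverts G \<and> {u, v} \<notin> gedges G}"
proof -
  let ?V = "gverts G"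
  let ?r = "{(u, v). u \<in> ?V \<and> v \<in> ?V \<and> {u, v} \<notin> gedges G}"
  have part: "partition_on ?V Ps"
    and E: "gedges G = {{u, v} | u v. \<exists>B\<in>Ps. \<exists>C\<in>Ps. B \<noteq> C \<and> u \<in> B \<and> v \<in> C}"
    using assms unfolding complete_multipartite_def by auto
  have uniq: "B = C" if "B \<in> Ps" "C \<in> Ps" "u \<in> B" "u \<in> C" for B C u
    using partition_onD2[OF part] that unfolding disjoint_def by blast
  have sub: "B \<subseteq> ?V" if "B \<in> Ps" for B
    using partition_onD1[OF part] that by blast
  have adj: "{u, v} \<in> gedges G \<longleftrightarrow> v \<notin> B" if "B \<in> Ps" "u \<in> B" "v \<in> ?V" for u v B
  proof
    assume "{u, v} \<in> gedges G"
    then obtain a b C D where *: "{u, v} = {a, b}" "C \<in> Ps" "D \<in> Ps" "C \<noteq> D" "a \<in> C" "b \<in> D"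
      unfolding E by blast
    have "False" if "v \<in> B"
    proof -
      have "a \<in> B" "b \<in> B" using *(1) \<open>u \<in> B\<close> that by (auto simp: doubleton_eq_iff)
      then have "B = C" "B = D"
        using uniq[OF \<open>B \<in> Ps\<close> *(2) _ *(5)] uniq[OF \<open>B \<in> Ps\<close> *(3) _ *(6)] by simp_all
      then show False using *(4) by simp
    qed
    then show "v \<notin> B" ..
  next
    assume "v \<notin> B"
    obtain C where C: "C \<in> Ps" "v \<in> C"
      using \<open>v \<in> ?V\<close> unfolding partition_onD1[OF part] by (rule UnionE)
    have "B \<noteq> C" using C(2) \<open>v \<notin> B\<close> by metis
    then have "\<exists>B\<in>Ps. \<exists>C\<in>Ps. B \<noteq> C \<and> u \<in> B \<and> v \<in> C"
      using that C by (intro bexI conjI)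
    then show "{u, v} \<in> gedges G" unfolding E by (intro CollectI exI[of _ u] exI[of _ v]) simp
  qed
  have cls: "?r `` {u} = B" if "B \<in> Ps" "u \<in> B" for u B
    using adj[OF that] sub[OF that(1)] that by blast
  show ?thesis
  proof (intro set_eqI iffI)
    fix B assume B: "B \<in> Ps"
    then obtain u where "u \<in> B" using partition_onD3[OF part] by (metis ex_in_conv)
    then have "u \<in> ?V" "?r `` {u} = B" by (rule subsetD[OF sub[OF B]], rule cls[OF B])
    then show "B \<in> ?V // ?r" using quotientI[of u ?V ?r] by simp
  next
    fix B assume "B \<in> ?V // ?r"
    then obtain u where u: "u \<in> ?V" "B = ?r `` {u}" by (rule quotientE)
    obtain C where "C \<in> Ps" "u \<in> C"
      using u(1) unfolding partition_onD1[OF part] by (rule UnionE)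
    then show "B \<in> Ps" using cls[of C u] u(2) by simp
  qed
qed

lemma (in Ultrametric_space) diametrical_graph_multipartite:
  assumes "finite A" "A \<subseteq> M" "2 \<le> card A"
  shows "complete_multipartite (diametrical_graph d A) Ps \<longleftrightarrow>
           Ps = A // {(u, v). u \<in> A \<and> v \<in> A \<and> d u v < mdiam d A}"
proof -
  let ?D = "mdiam d A"
  let ?r = "{(u, v). u \<in> A \<and> v \<in> A \<and> d u v < ?D}"
  let ?G = "diametrical_graph d A"
  have ne: "A \<noteq> {}" using assms by auto
  have Dmax: "?D = Max ((\<lambda>(x, y). d x y) ` (A \<times> A))"
    using mdiam_eq_Max assms(1) ne by blast
  have le: "d u v \<le> ?D" if "u \<in> A" "v \<in> A" for u v
    unfolding Dmax using that assms(1) by (intro Max_ge) auto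
  obtain p q where pq: "p \<in> A" "q \<in> A" "p \<noteq> q"
    using assms(3) by (metis card_le_Suc0_iff_eq assms(1) not_less_eq_eq numeral_2_eq_2)
  then have pos: "0 < ?D" using le[of p q] mdist_pos_less[of p q] assms(2) by fastforce
  have "Max ((\<lambda>(x, y). d x y) ` (A \<times> A)) \<in> (\<lambda>(x, y). d x y) ` (A \<times> A)"
    using assms(1) ne by (intro Max_in) auto
  then obtain a b where ab: "a \<in> A" "b \<in> A" "d a b = ?D"
    unfolding Dmax by auto
  have eqv: "equiv A ?r"
  proof (rule equivI)
    show "?r \<subseteq> A \<times> A" by auto
    show "refl_on A ?r" using pos assms(2) by (auto simp: refl_on_def)
    show "sym ?r"
    proof (rule symI)
      fix x y assume "(x, y) \<in> ?r"
      then show "(y, x) \<in> ?r" using commute[of x y] by simp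
    qed
    show "trans ?r"
    proof (rule transI)
      fix x y z assume "(x, y) \<in> ?r" "(y, z) \<in> ?r"
      then have "x \<in> A" "y \<in> A" "z \<in> A" "d x y < ?D" "d y z < ?D" by auto
      then show "(x, z) \<in> ?r"
        using strong_triangle[of x z y] assms(2) by (simp add: subset_iff max_def split: if_splits)
    qed
  qed
  have edge: "{u, v} \<in> gedges ?G \<longleftrightarrow> d u v = ?D" if "u \<in> A" "v \<in> A" for u v
  proof
    assume "{u, v} \<in> gedges ?G"
    then obtain x y where "{u, v} = {x, y}" "d x y = ?D"
      by (auto simp: diametrical_graph_def)
    then show "d u v = ?D" using commute[of u v] by (auto simp: doubleton_eq_iff)
  next
    assume "d u v = ?D"
    moreover from this have "u \<noteq> v" using pos that assms(2) by auto
    ultimately show "{u, v} \<in> gedges ?G" using that by (auto simp: diametrical_graph_def)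
  qed
  have nonadj: "{(u, v). u \<in> A \<and> v \<in> A \<and> {u, v} \<notin> gedges ?G} = ?r"
    using edge le by (auto simp: order_less_le)
  have gv: "gverts ?G = A" by (simp add: diametrical_graph_def)
  have "complete_multipartite ?G (A // ?r)"
    unfolding complete_multipartite_def gv
  proof (intro conjI)
    show "partition_on A (A // ?r)" using eqv by (rule partition_on_quotient)
    have fin: "finite (A // ?r)" using assms(1) by (intro finite_quotient) auto
    have "?r `` {a} \<noteq> ?r `` {b}"
      using eq_equiv_class_iff[OF eqv ab(1,2)] ab by auto
    moreover have "{?r `` {a}, ?r `` {b}} \<subseteq> A // ?r"
      by (intro subsetI) (use quotientI[OF ab(1), of ?r] quotientI[OF ab(2), of ?r] in \<open>elim insertE emptyE; simp only:\<close>)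
    ultimately show "2 \<le> card (A // ?r)"
      using card_mono[OF fin, of "{?r `` {a}, ?r `` {b}}"] by simp
    show "gedges ?G = {{u, v} | u v. \<exists>B\<in>A // ?r. \<exists>C\<in>A // ?r. B \<noteq> C \<and> u \<in> B \<and> v \<in> C}"
      (is "_ = ?E")
    proof (intro set_eqI iffI)
      fix e assume "e \<in> gedges ?G"
      then obtain u v where e: "e = {u, v}" "u \<in> A" "v \<in> A" "d u v = ?D"
        by (auto simp: diametrical_graph_def)
      then have "?r `` {u} \<noteq> ?r `` {v}"
        using eq_equiv_class_iff[OF eqv e(2,3)] by auto
      moreover have "u \<in> ?r `` {u}" "v \<in> ?r `` {v}"
        using equiv_class_self[OF eqv] e by auto
      moreover have "?r `` {u} \<in> A // ?r" "?r `` {v} \<in> A // ?r"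
        by (rule quotientI[OF e(2)], rule quotientI[OF e(3)])
      ultimately have "\<exists>B\<in>A // ?r. \<exists>C\<in>A // ?r. B \<noteq> C \<and> u \<in> B \<and> v \<in> C"
        by (intro bexI conjI)
      then show "e \<in> ?E" using e(1) by (intro CollectI exI[of _ u] exI[of _ v]) simp
    next
      fix e assume "e \<in> ?E"
      then obtain u v B C where e: "e = {u, v}" "B \<in> A // ?r" "C \<in> A // ?r" "B \<noteq> C"
        "u \<in> B" "v \<in> C" by blast
      have A: "u \<in> A" "v \<in> A"
        using Union_quotient[OF eqv] UnionI[OF e(2,5)] UnionI[OF e(3,6)] by simp_all
      have "(u, v) \<notin> ?r" using quotient_eqI[OF eqv e(2,3,5,6)] e(4) by (rule contrapos_nn[rotated])
      then have "d u v = ?D" using le[OF A] A by auto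
      then show "e \<in> gedges ?G" using edge[OF A] e(1) by blast
    qed
  qed
  moreover have "Ps = A // ?r" if "complete_multipartite ?G Ps"
    using multipartite_parts_unique[OF that] unfolding gv nonadj .
  ultimately show ?thesis by blast
qed

end

theory Submission
  imports Defs
begin

text \<open>
  Two facts carry the proof.

  First, a minimum spanning path realises the metric as a bottleneck: the distance of two of
  its vertices is the largest step between them. One inequality is the strong triangle
  inequality (\<open>dist_le_if_steps_le\<close>). For the other one (\<open>step_le_dist\<close>), if a
  step between two vertices were longer than their distance \<open>D\<close>, then reversing a suitable
  segment of the path would replace two steps longer than \<open>D\<close> by one of length at most
  \<open>D\<close> and one that is at most the longer of the two (or, for a segment at the end of the
  path, a single step by a shorter one), so a shorter path would result. As this
  move stays within paths, the only spanning trees needed for comparison are paths.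

  Secondly, a node of the representing tree with label \<open>D\<close> is the closed ball of radius
  \<open>D\<close> around each of its points (\<open>node_is_ball\<close>), and any two distinct points lie
  in a common node labelled by their distance (\<open>node_of_pair\<close>).

  Together these say that the nodes with label \<open>D > 0\<close> are the maximal segments of the path
  that have all steps at most \<open>D\<close> and contain a step equal to \<open>D\<close>. Two different
  nodes with the same label \<open>D\<close> therefore amount to two steps equal to \<open>D\<close> that are
  separated by a longer step.
\<close>

section \<open>Paths as spanning trees\<close>

text \<open>The vertex of a cycle that comes last along the path has two different neighbours on the
  cycle, but along the path it has only one earlier neighbour.\<close>

lemma path_graph_acyclic:
  assumes "distinct xs"
  shows "\<not> sgraph_cycle (set xs, path_edges xs) ys"
proof
  assume cyc: "sgraph_cycle (set xs, path_edges xs) ys"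
  define n where "n = length ys"
  have n: "3 \<le> n" and dys: "distinct ys" and sub: "set ys \<subseteq> set xs"
    and pe: "path_edges ys \<subseteq> path_edges xs" and cl: "{last ys, hd ys} \<in> path_edges xs"
    using cyc by (auto simp: sgraph_cycle_def n_def)
  have "\<forall>y\<in>set xs. \<exists>i. i < length xs \<and> xs ! i = y"
    by (simp add: in_set_conv_nth)
  then obtain f where f: "\<And>y. y \<in> set xs \<Longrightarrow> f y < length xs \<and> xs ! f y = y"
    by metis
  have adj: "f y = Suc (f z) \<or> f z = Suc (f y)"
    if "{y, z} \<in> path_edges xs" "y \<in> set xs" "z \<in> set xs" for y z
  proof -
    obtain i where i: "{y, z} = {xs ! i, xs ! Suc i}" "Suc i < length xs"
      using \<open>{y, z} \<in> path_edges xs\<close> by (auto simp: path_edges_def)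
    have "f (xs ! k) = k" if "k < length xs" for k
      using f[of "xs ! k"] that nth_eq_iff_index_eq[OF \<open>distinct xs\<close>, of "f (xs ! k)" k] by simp
    then have "f (xs ! i) = i" "f (xs ! Suc i) = Suc i" using i(2) by auto
    then show ?thesis using i(1) by (auto simp: doubleton_eq_iff)
  qed
  have inS: "ys ! p \<in> set xs" if "p < n" for p using sub that by (auto simp: n_def)
  have edge: "{ys ! p, ys ! (Suc p mod n)} \<in> path_edges xs" if "p < n" for p
  proof (cases "Suc p < n")
    case True
    then show ?thesis using pe by (auto simp: path_edges_def n_def)
  next
    case False
    then have "p = n - 1" using that by simp
    moreover have "ys \<noteq> []" using n n_def by auto
    ultimately show ?thesis using cl n by (simp add: last_conv_nth hd_conv_nth n_def)
  qed
  have "0 \<in> {..<n}" using n by simp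
  then have "finite ((\<lambda>p. f (ys ! p)) ` {..<n})" "(\<lambda>p. f (ys ! p)) ` {..<n} \<noteq> {}"
    by blast+
  then have "Max ((\<lambda>p. f (ys ! p)) ` {..<n}) \<in> (\<lambda>p. f (ys ! p)) ` {..<n}"
    by (rule Max_in)
  then obtain p where p: "p < n" "f (ys ! p) = Max ((\<lambda>p. f (ys ! p)) ` {..<n})" by auto
  have mx: "f (ys ! q) \<le> f (ys ! p)" if "q < n" for q
    unfolding p(2) using that by (intro Max_ge) auto
  define q where "q = (if p = 0 then n - 1 else p - 1)"
  define r where "r = Suc p mod n"
  have q: "q < n" "Suc q mod n = p" using p(1) n by (auto simp: q_def)
  have r: "r < n" using n by (simp add: r_def)
  have "q \<noteq> r"
  proof (cases "Suc p < n")
    case True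
    then show ?thesis using n by (auto simp: q_def r_def)
  next
    case False
    then have "Suc p = n" using p(1) by simp
    then have "r = 0" by (simp add: r_def)
    then show ?thesis using \<open>Suc p = n\<close> n by (auto simp: q_def)
  qed
  have "f (ys ! p) = Suc (f (ys ! q))"
    using adj[OF edge[OF q(1)]] inS q p(1) mx[OF q(1)] by fastforce
  moreover have "f (ys ! p) = Suc (f (ys ! r))"
    using adj[OF edge[OF p(1)]] inS p(1) r mx[OF r] unfolding r_def by fastforce
  ultimately have "ys ! q = ys ! r"
    using f[OF inS[OF q(1)]] f[OF inS[OF r]] by simp
  then show False using dys q(1) r \<open>q \<noteq> r\<close> by (simp add: nth_eq_iff_index_eq n_def)
qed

lemma path_graph_connected: "sgraph_connected (set xs, path_edges xs)"
proof -
  let ?R = "{(a, b). {a, b} \<in> path_edges xs}"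
  have sym: "sym (?R\<^sup>*)" by (intro sym_rtrancl) (auto simp: sym_def insert_commute)
  have le: "(xs ! i, xs ! j) \<in> ?R\<^sup>*" if "i \<le> j" "j < length xs" for i j
    using that
  proof (induction j rule: dec_induct)
    case (step m)
    then have "(xs ! m, xs ! Suc m) \<in> ?R" by (auto simp: path_edges_def)
    with step show ?case by (meson Suc_lessD rtrancl.rtrancl_into_rtrancl)
  qed simp
  have "(xs ! i, xs ! j) \<in> ?R\<^sup>*" if "i < length xs" "j < length xs" for i j
    using le[of i j] le[of j i] that symD[OF sym] by (metis nle_le)
  then show ?thesis by (auto simp: sgraph_connected_def in_set_conv_nth)
qed

lemma path_graph_spanning_tree:
  assumes "distinct xs" "xs \<noteq> []"
  shows "sgraph_spanning_tree (set xs, path_edges xs) (complete_sgraph (set xs))"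
proof -
  have "path_edges xs \<subseteq> gedges (complete_sgraph (set xs))"
  proof
    fix e assume "e \<in> path_edges xs"
    then obtain i where i: "e = {xs ! i, xs ! Suc i}" "Suc i < length xs"
      by (auto simp: path_edges_def)
    then have "xs ! i \<noteq> xs ! Suc i" using assms by (simp add: nth_eq_iff_index_eq)
    then show "e \<in> gedges (complete_sgraph (set xs))"
      unfolding complete_sgraph_def snd_conv
      using i by (intro CollectI exI[of _ "xs ! i"] exI[of _ "xs ! Suc i"]) simp
  qed
  then show ?thesis
    using path_graph_acyclic[OF assms(1)] path_graph_connected[of xs] assms
    unfolding sgraph_spanning_tree_def sgraph_tree_def sgraph_def
    by (simp add: complete_sgraph_def)
qed

section \<open>Path spectra\<close>

lemma length_path_spectrum [simp]: "length (path_spectrum d xs) = length xs - 1"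
  by (simp add: path_spectrum_def)

lemma path_spectrum_nth: "Suc i < length xs \<Longrightarrow> path_spectrum d xs ! i = d (xs ! i) (xs ! Suc i)"
  by (simp add: path_spectrum_def less_diff_conv)

lemma path_spectrum_Nil [simp]: "path_spectrum d [] = []"
  by (simp add: path_spectrum_def)

lemma path_spectrum_singleton [simp]: "path_spectrum d [x] = []"
  by (simp add: path_spectrum_def)

lemma path_spectrum_Cons_Cons [simp]:
  "path_spectrum d (x # y # xs) = d x y # path_spectrum d (y # xs)"
  by (rule nth_equalityI) (auto simp: path_spectrum_nth nth_Cons split: nat.split)

lemma path_spectrum_append:
  assumes "ys \<noteq> []" "zs \<noteq> []"
  shows "path_spectrum d (ys @ zs) =
    path_spectrum d ys @ d (last ys) (hd zs) # path_spectrum d zs"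
  using assms(1)
proof (induction ys rule: list_nonempty_induct)
  case (single y)
  then show ?case using assms(2) by (cases zs) auto
next
  case (cons y ys)
  then show ?case by (cases ys) auto
qed

lemma (in Metric_space) path_spectrum_rev: "path_spectrum d (rev ys) = rev (path_spectrum d ys)"
proof (induction ys)
  case (Cons y ys)
  show ?case
  proof (cases ys)
    case (Cons z zs)
    have "path_spectrum d (rev ys @ [y]) = path_spectrum d (rev ys) @ [d z y]"
      using Cons by (subst path_spectrum_append) auto
    then show ?thesis using Cons.IH Cons commute[of y z] by simp
  qed simp
qed simp

lemma (in Metric_space) total_weight_path:
  assumes "distinct xs"
  shows "total_weight d (set xs, path_edges xs) = sum_list (path_spectrum d xs)"
proof -
  let ?e = "\<lambda>i. {xs ! i, xs ! Suc i}"
  have E: "path_edges xs = ?e ` {..<length xs - 1}"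
    by (auto simp: path_edges_def)
  have "inj_on ?e {..<length xs - 1}"
    using assms by (intro inj_onI) (auto simp: doubleton_eq_iff nth_eq_iff_index_eq)
  then have "total_weight d (set xs, path_edges xs)
      = (\<Sum>i<length xs - 1. edge_weight d (?e i))"
    by (simp add: total_weight_def E sum.reindex)
  also have "\<dots> = (\<Sum>i<length xs - 1. path_spectrum d xs ! i)"
    using assms
    by (intro sum.cong) (auto simp: path_spectrum_nth edge_weight_doubleton nth_eq_iff_index_eq)
  also have "\<dots> = sum_list (path_spectrum d xs)"
    by (simp add: sum_list_sum_nth atLeast0LessThan)
  finally show ?thesis .
qed

section \<open>Bottleneck distances along a shortest path\<close>

definition shortest_numbering :: "'a set \<Rightarrow> ('a \<Rightarrow> 'a \<Rightarrow> real) \<Rightarrow> 'a list \<Rightarrow> bool" where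
  "shortest_numbering X d xs \<longleftrightarrow> distinct xs \<and> set xs = X \<and>
     (\<forall>ys. distinct ys \<and> set ys = X \<longrightarrow>
        sum_list (path_spectrum d xs) \<le> sum_list (path_spectrum d ys))"

lemma (in Metric_space) min_spanning_path_shortest:
  assumes "P \<in> min_spanning_paths M d" "path_numbering P xs"
  shows "shortest_numbering M d xs"
proof -
  have P: "P = (set xs, path_edges xs)" and xs: "distinct xs" "xs \<noteq> []"
    using assms(2) by (cases P; simp add: path_numbering_def)+
  have M: "set xs = M"
    using assms(1) unfolding min_spanning_paths_def min_spanning_trees_def
    by (simp add: sgraph_spanning_tree_def complete_sgraph_def P)
  have "sum_list (path_spectrum d xs) \<le> sum_list (path_spectrum d ys)"
    if ys: "distinct ys" "set ys = M" for ys
  proof -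
    have "ys \<noteq> []" using M xs(2) ys(2) by auto
    then have "sgraph_spanning_tree (set ys, path_edges ys) (complete_sgraph M)"
      using path_graph_spanning_tree[of ys] ys by simp
    then have "total_weight d P \<le> total_weight d (set ys, path_edges ys)"
      using assms(1) by (simp add: min_spanning_paths_def min_spanning_trees_def)
    then show ?thesis using total_weight_path xs(1) ys(1) P by simp
  qed
  then show ?thesis using xs(1) M by (simp add: shortest_numbering_def)
qed

context Ultrametric_space
begin

lemma dist_le_if_steps_le:
  assumes "set xs \<subseteq> M" "0 \<le> D" "i \<le> j" "j < length xs"
    and "\<And>k. i \<le> k \<Longrightarrow> k < j \<Longrightarrow> d (xs ! k) (xs ! Suc k) \<le> D"
  shows "d (xs ! i) (xs ! j) \<le> D"
  using assms(3-)
proof (induction j rule: dec_induct)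
  case base
  then show ?case using assms(1,2) by (simp add: subset_iff)
next
  case (step m)
  have "d (xs ! i) (xs ! Suc m) \<le> max (d (xs ! i) (xs ! m)) (d (xs ! m) (xs ! Suc m))"
    using assms(1) step by (intro strong_triangle) (auto simp: subset_iff)
  also have "\<dots> \<le> D" using step by simp
  finally show ?case .
qed

text \<open>Reversing \<open>ys\<close> replaces the two steps at its ends, both longer than \<open>D\<close>,
  by a step of length at most \<open>D\<close> and a step that by the strong triangle inequality is at
  most the longer of the two. If \<open>zs\<close> is empty there is only one step to replace.\<close>

lemma shortest_numbering_no_shortcut:
  assumes short: "shortest_numbering M d (ws @ ys @ zs)" and ne: "ws \<noteq> []" "ys \<noteq> []"
    and D: "d (last ws) (last ys) \<le> D" and left: "D < d (last ws) (hd ys)"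
    and right: "zs \<noteq> [] \<Longrightarrow> D < d (last ys) (hd zs)"
  shows False
proof -
  have "sum_list (path_spectrum d (ws @ ys @ zs)) \<le> sum_list (path_spectrum d (ws @ rev ys @ zs))"
    using short by (simp add: shortest_numbering_def)
  moreover have "sum_list (path_spectrum d (ws @ rev ys @ zs)) < sum_list (path_spectrum d (ws @ ys @ zs))"
  proof (cases "zs = []")
    case True
    then show ?thesis using ne D left
      by (simp add: path_spectrum_append path_spectrum_rev hd_rev)
  next
    case False
    have M: "last ws \<in> M" "hd ys \<in> M" "last ys \<in> M" "hd zs \<in> M"
      using short ne False by (auto simp: shortest_numbering_def)
    have "d (hd ys) (hd zs) \<le> max (d (hd ys) (last ws)) (d (last ws) (hd zs))"
      "d (last ws) (hd zs) \<le> max (d (last ws) (last ys)) (d (last ys) (hd zs))"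
      using M by (auto intro: strong_triangle)
    then have "d (last ws) (last ys) + d (hd ys) (hd zs)
        < d (last ws) (hd ys) + d (last ys) (hd zs)"
      using D left right[OF False] commute[of "hd ys" "last ws"] by linarith
    then show ?thesis using ne False
      by (simp add: path_spectrum_append path_spectrum_rev hd_rev last_rev)
  qed
  ultimately show False by simp
qed

text \<open>Were some step longer than \<open>D = d (xs ! i) (xs ! j)\<close>, then moving \<open>i\<close> and
  \<open>j\<close> forward over steps of length at most \<open>D\<close> keeps their distance at most
  \<open>D\<close> and makes them the ends of a segment whose reversal shortens the path.\<close>

lemma step_le_dist:
  assumes short: "shortest_numbering M d xs"
    and ij: "i \<le> k" "k < j" "j < length xs"
  shows "d (xs ! k) (xs ! Suc k) \<le> d (xs ! i) (xs ! j)"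
proof (rule ccontr)
  define D where "D = d (xs ! i) (xs ! j)"
  assume "\<not> ?thesis"
  then have k: "i \<le> k \<and> D < d (xs ! k) (xs ! Suc k)" using ij by (simp add: D_def)
  have sub: "set xs \<subseteq> M" and M: "\<And>t. t < length xs \<Longrightarrow> xs ! t \<in> M"
    using short by (auto simp: shortest_numbering_def)
  have D0: "0 \<le> D" by (simp add: D_def)
  define a where "a = (LEAST t. i \<le> t \<and> D < d (xs ! t) (xs ! Suc t))"
  have a: "i \<le> a" "D < d (xs ! a) (xs ! Suc a)"
    using LeastI[of "\<lambda>t. i \<le> t \<and> D < d (xs ! t) (xs ! Suc t)", OF k] by (auto simp: a_def)
  have "a \<le> k" unfolding a_def by (rule Least_le) (rule k)
  have a_steps: "d (xs ! t) (xs ! Suc t) \<le> D" if "i \<le> t" "t < a" for t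
    using not_less_Least[OF that(2)[unfolded a_def]] that(1) by auto
  \<comment> \<open>If no step after \<open>j\<close> is longer than \<open>D\<close>, then \<open>b\<close> is the end of the path.\<close>
  let ?B = "\<lambda>t. j \<le> t \<and> (Suc t < length xs \<longrightarrow> D < d (xs ! t) (xs ! Suc t))"
  define b where "b = (LEAST t. ?B t)"
  have ex: "?B (length xs - 1)" using ij by auto
  have b: "?B b" unfolding b_def by (rule LeastI[of ?B, OF ex])
  have "b \<le> length xs - 1" unfolding b_def by (rule Least_le[of ?B, OF ex])
  then have bl: "b < length xs" using ij by linarith
  have b_steps: "d (xs ! t) (xs ! Suc t) \<le> D" if "j \<le> t" "t < b" for t
    using not_less_Least[of t ?B] that by (auto simp: b_def)
  have ab: "a < b" using \<open>a \<le> k\<close> ij b by linarith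
  have "d (xs ! i) (xs ! a) \<le> D"
    using dist_le_if_steps_le[OF sub D0 a(1)] a_steps ab bl by simp
  moreover have "d (xs ! j) (xs ! b) \<le> D"
    using dist_le_if_steps_le[OF sub D0] b_steps b bl by simp
  moreover have "d (xs ! a) (xs ! b) \<le> max (d (xs ! a) (xs ! i)) (d (xs ! i) (xs ! b))"
    "d (xs ! i) (xs ! b) \<le> max (d (xs ! i) (xs ! j)) (d (xs ! j) (xs ! b))"
    using M ij ab bl \<open>a \<le> k\<close> by (auto intro!: strong_triangle)
  ultimately have dab: "d (xs ! a) (xs ! b) \<le> D"
    using commute[of "xs ! a" "xs ! i"] by (simp add: D_def max_def split: if_splits)
  let ?ws = "take (Suc a) xs" and ?ys = "drop (Suc a) (take (Suc b) xs)" and ?zs = "drop (Suc b) xs"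
  have "xs = ?ws @ ?ys @ ?zs"
    using ab by (metis append_assoc append_take_drop_id min.absorb1 take_take Suc_le_mono less_imp_le)
  then have "shortest_numbering M d (?ws @ ?ys @ ?zs)" using short by simp
  moreover have "?ws \<noteq> []" "?ys \<noteq> []" using ab bl by auto
  moreover have "hd ?ys = xs ! Suc a" using ab bl by (simp add: hd_drop_conv_nth)
  moreover have "last ?ws = xs ! a" "last ?ys = xs ! b"
    using ab bl last_drop[of "Suc a" "take (Suc b) xs"]
    by (simp_all add: take_Suc_conv_app_nth)
  moreover have "hd ?zs = xs ! Suc b" "Suc b < length xs" if "?zs \<noteq> []"
    using that by (auto simp: hd_drop_conv_nth)
  ultimately show False
    using shortest_numbering_no_shortcut[of ?ws ?ys ?zs D] dab a(2) b by metis
qed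

section \<open>Nodes of the representing tree as balls\<close>

lemma dist_le_mdiam:
  assumes "finite A" "x \<in> A" "y \<in> A"
  shows "d x y \<le> mdiam d A"
proof -
  have "A \<noteq> {}" using assms by auto
  then show ?thesis
    unfolding mdiam_eq_Max[OF assms(1) \<open>A \<noteq> {}\<close>] using assms by (intro Max_ge) auto
qed

lemma mdiam_attained:
  assumes "finite A" "A \<noteq> {}"
  obtains x y where "x \<in> A" "y \<in> A" "d x y = mdiam d A"
proof -
  have "Max ((\<lambda>(x, y). d x y) ` (A \<times> A)) \<in> (\<lambda>(x, y). d x y) ` (A \<times> A)"
    using assms by (intro Max_in) auto
  then show thesis using that by (auto simp: mdiam_eq_Max[OF assms])
qed

lemma node_children_iff:
  assumes "finite A" "A \<subseteq> M"
  shows "B \<in> node_children d A \<longleftrightarrow>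
    2 \<le> card A \<and> (\<exists>x\<in>A. B = {y \<in> A. d x y < mdiam d A})"
proof (cases "2 \<le> card A")
  case True
  have "{(u, v). u \<in> A \<and> v \<in> A \<and> d u v < mdiam d A} `` {x} = {y \<in> A. d x y < mdiam d A}"
    if "x \<in> A" for x using that by auto
  then show ?thesis
    using True unfolding node_children_def diametrical_graph_multipartite[OF assms True]
    by (auto simp: quotient_def)
qed (simp add: node_children_def)

abbreviation "nodes \<equiv> tree_nodes (representing_tree M d)"

lemma root_node: "M \<in> nodes"
  by (simp add: representing_tree_def)

lemma child_node: "A \<in> nodes \<Longrightarrow> B \<in> node_children d A \<Longrightarrow> B \<in> nodes"
  by (auto simp: representing_tree_def intro: rtrancl_into_rtrancl)

text \<open>A point leaves the descending chain of nodes around \<open>x\<close> at a node whose diameter is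
  its distance from \<open>x\<close>, and diameters decrease strictly from a node to its children.\<close>

lemma node_isolated:
  assumes "finite M" "M \<noteq> {}" "B \<in> nodes"
  shows "B \<subseteq> M \<and> B \<noteq> {} \<and> (\<forall>x\<in>B. \<forall>y\<in>M - B. mdiam d B < d x y)"
proof -
  have "(M, B) \<in> {(A, B). B \<in> node_children d A}\<^sup>*"
    using assms(3) by (simp add: representing_tree_def)
  then show ?thesis
  proof (induction rule: rtrancl_induct)
    case base
    then show ?case using assms(2) by simp
  next
    case (step A B)
    then have A: "A \<subseteq> M" "A \<noteq> {}" "\<And>x y. x \<in> A \<Longrightarrow> y \<in> M - A \<Longrightarrow> mdiam d A < d x y"
      by auto
    have fA: "finite A" using A(1) assms(1) finite_subset by blast
    obtain x where x: "x \<in> A" and B: "B = {y \<in> A. d x y < mdiam d A}" and card: "2 \<le> card A"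
      using step(2) node_children_iff[OF fA A(1), of B] by auto
    have "\<exists>y\<in>A. y \<noteq> x"
    proof (rule ccontr)
      assume "\<not> ?thesis"
      then have "A \<subseteq> {x}" by auto
      then have "card A \<le> 1" using card_mono[of "{x}" A] by simp
      then show False using card by simp
    qed
    then obtain y where y: "y \<in> A" "y \<noteq> x" by blast
    then have "0 < d x y" using mdist_pos_less[OF y(2)[symmetric]] x A(1) by blast
    then have "0 < mdiam d A" using dist_le_mdiam[OF fA x y(1)] by linarith
    then have xB: "x \<in> B" using x A(1) B by auto
    have fB: "finite B" using fA B by simp
    obtain a b where ab: "a \<in> B" "b \<in> B" "d a b = mdiam d B"
      using mdiam_attained[OF fB] xB by blast
    have "d a b \<le> max (d a x) (d x b)" using ab x B A(1) by (intro strong_triangle) auto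
    then have less: "mdiam d B < mdiam d A"
      using ab B commute[of a x] by (auto simp: max_def split: if_splits)
    have "mdiam d B < d z y" if zy: "z \<in> B" "y \<in> M - B" for z y
    proof (cases "y \<in> A")
      case True
      have "d x y \<le> max (d x z) (d z y)" using zy x B A(1) by (intro strong_triangle) auto
      moreover have "mdiam d A \<le> d x y" using True zy B by auto
      ultimately have "mdiam d A \<le> d z y" using zy B by (auto simp: max_def split: if_splits)
      then show ?thesis using less by simp
    next
      case False
      then show ?thesis using A(3)[of z y] zy B less by fastforce
    qed
    then show ?case using xB B A(1) by blast
  qed
qed

lemma node_is_ball:
  assumes "finite M" "B \<in> nodes" "x \<in> B"
  shows "y \<in> B \<longleftrightarrow> y \<in> M \<and> d x y \<le> mdiam d B"
proof -
  have "M \<noteq> {}"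
  proof
    assume "M = {}"
    moreover from this have "node_children d M = {}" by (simp add: node_children_def)
    ultimately have "B = M"
      using assms(2) by (auto simp: representing_tree_def elim: converse_rtranclE)
    then show False using \<open>M = {}\<close> assms(3) by simp
  qed
  note iso = node_isolated[OF assms(1) this assms(2)]
  then have "finite B" using assms(1) finite_subset by blast
  then have "d x y \<le> mdiam d B" if "y \<in> B" using dist_le_mdiam assms(3) that by simp
  moreover have "mdiam d B < d x y" if "y \<in> M - B" using iso assms(3) that by blast
  ultimately show ?thesis using iso by (metis DiffI not_less subsetD)
qed

text \<open>Descend from the root: while the diameter of a node containing both points exceeds their
  distance, one of its children contains both.\<close>

lemma node_of_pair:
  assumes "finite M" "x \<in> M" "y \<in> M" "x \<noteq> y"
  obtains B where "B \<in> nodes" "x \<in> B" "y \<in> B" "mdiam d B = d x y"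
proof -
  have "\<exists>B\<in>nodes. x \<in> B \<and> y \<in> B \<and> mdiam d B = d x y"
    if "A \<in> nodes" "x \<in> A" "y \<in> A" for A
    using that
  proof (induction "card A" arbitrary: A rule: less_induct)
    case less
    have "A \<subseteq> M" using node_isolated[OF assms(1) _ less(2)] assms(2) by auto
    have fA: "finite A" using \<open>A \<subseteq> M\<close> assms(1) finite_subset by blast
    show ?case
    proof (cases "mdiam d A = d x y")
      case False
      then have lt: "d x y < mdiam d A" using dist_le_mdiam[OF fA less(3,4)] by simp
      define B where "B = {z \<in> A. d x z < mdiam d A}"
      have "card {x, y} \<le> card A" using fA less by (intro card_mono) auto
      then have "2 \<le> card A" using assms(4) by simp
      then have "B \<in> node_children d A"
        using node_children_iff[OF fA \<open>A \<subseteq> M\<close>] less(3) by (auto simp: B_def)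
      then have "B \<in> nodes" using child_node less(2) by blast
      have "d x x < mdiam d A" using le_less_trans[OF nonneg lt] assms(2) by simp
      then have xy: "x \<in> B" "y \<in> B" using lt less by (auto simp: B_def)
      have "B \<noteq> A"
      proof
        assume "B = A"
        obtain a b where ab: "a \<in> A" "b \<in> A" "d a b = mdiam d A"
          using mdiam_attained[OF fA] less(3) by blast
        have "d a b \<le> max (d a x) (d x b)"
          using ab \<open>A \<subseteq> M\<close> assms(2) by (intro strong_triangle) auto
        moreover have "d x a < mdiam d A" "d x b < mdiam d A"
          using ab \<open>B = A\<close> by (auto simp: B_def)
        ultimately show False using ab(3) commute[of a x] by simp
      qed
      then have "card B < card A" using fA by (intro psubset_card_mono) (auto simp: B_def)
      then show ?thesis using less(1)[of B] \<open>B \<in> nodes\<close> xy by blast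
    qed (use less in auto)
  qed
  from this[OF root_node assms(2,3)] show thesis using that by blast
qed

section \<open>Equal labels and equal steps\<close>

text \<open>The diameter is attained by two vertices; the steps between them are bounded by their
  distance, not all strictly, and do not leave the ball.\<close>

lemma node_contains_diameter_step:
  assumes short: "shortest_numbering M d xs" and B: "B \<in> nodes" "0 < mdiam d B"
  obtains t where "Suc t < length xs" "xs ! t \<in> B" "d (xs ! t) (xs ! Suc t) = mdiam d B"
proof -
  have xs: "set xs = M" using short by (simp add: shortest_numbering_def)
  then have fM: "finite M" by auto
  have "M \<noteq> {}"
    using B by (force simp: representing_tree_def mdiam_def node_children_def elim: converse_rtranclE)
  then have "B \<subseteq> M" "B \<noteq> {}" using node_isolated[OF fM _ B(1)] by auto
  then obtain x y where xy: "x \<in> B" "y \<in> B" "d x y = mdiam d B"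
    using mdiam_attained[of B] fM finite_subset by metis
  then obtain p q where "p < length xs" "xs ! p = x" "q < length xs" "xs ! q = y"
    using \<open>B \<subseteq> M\<close> xs by (metis in_set_conv_nth subset_iff)
  moreover have "x \<noteq> y" using xy B(2) \<open>B \<subseteq> M\<close> by auto
  ultimately obtain i j where ij: "i < j" "j < length xs" "xs ! i \<in> B"
    "d (xs ! i) (xs ! j) = mdiam d B"
    using xy commute[of x y] by (metis nat_neq_iff)
  have le: "d (xs ! k) (xs ! Suc k) \<le> mdiam d B" if "i \<le> k" "k < j" for k
    using step_le_dist[OF short that ij(2)] ij(4) by simp
  \<comment> \<open>If all steps were smaller, then so would be their maximum, and thus the distance.\<close>
  have "\<exists>t. i \<le> t \<and> t < j \<and> mdiam d B \<le> d (xs ! t) (xs ! Suc t)"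
  proof (rule ccontr)
    assume "\<not> ?thesis"
    then have small: "d (xs ! k) (xs ! Suc k) < mdiam d B" if "i \<le> k" "k < j" for k
      using that by force
    let ?S = "(\<lambda>k. d (xs ! k) (xs ! Suc k)) ` {i..<j}"
    have fS: "finite ?S" "?S \<noteq> {}" using ij(1) by auto
    have nonneg_max: "0 \<le> Max ?S" using Max_in[OF fS] by auto
    have "d (xs ! i) (xs ! j) \<le> Max ?S"
    proof (rule dist_le_if_steps_le)
      fix k assume "i \<le> k" "k < j"
      then show "d (xs ! k) (xs ! Suc k) \<le> Max ?S" by (intro Max_ge[OF fS(1)] imageI) simp
    qed (use xs ij nonneg_max in simp_all)
    also have "\<dots> < mdiam d B" using fS small by (subst Max_less_iff) auto
    finally show False using ij(4) by simp
  qed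
  then obtain t where t: "i \<le> t" "t < j" "mdiam d B \<le> d (xs ! t) (xs ! Suc t)" by blast
  have "d (xs ! i) (xs ! t) \<le> mdiam d B"
  proof (rule dist_le_if_steps_le)
    fix k assume "i \<le> k" "k < t"
    then show "d (xs ! k) (xs ! Suc k) \<le> mdiam d B" using le t(2) by simp
  qed (use xs t(1,2) ij(2) B(2) in simp_all)
  then have "xs ! t \<in> B"
    using node_is_ball[OF fM B(1) ij(3)] xs t(2) ij(2) by auto
  then show thesis using that[of t] t le[OF t(1,2)] ij(2) by simp
qed

end

theorem proposition3p4:
  fixes X :: "'a set" and d :: "'a \<Rightarrow> 'a \<Rightarrow> real"
    and P :: "'a sgraph" and xs :: "'a list" and s :: "real list"
  assumes "Ultrametric_space X d"
    and "finite X" and "X \<noteq> {}"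
    and "P \<in> min_spanning_paths X d"
    and "path_numbering P xs"
    and "s = path_spectrum d xs"
  shows "(\<forall>u \<in> internal_nodes (representing_tree X d).
          \<forall>v \<in> internal_nodes (representing_tree X d). u \<noteq> v \<longrightarrow>
            tree_label (representing_tree X d) u \<noteq> tree_label (representing_tree X d) v)
     \<longleftrightarrow>
         (\<forall>i j. i < j \<and> j < length s \<and> s ! i = s ! j \<longrightarrow>
            (\<forall>k. i < k \<and> k < j \<longrightarrow> s ! k \<le> s ! i))"
    (is "?distinct_labels \<longleftrightarrow> ?none_longer_between")
proof -
  interpret Ultrametric_space X d by fact
  have short: "shortest_numbering X d xs"
    using min_spanning_path_shortest assms by blast
  then have xs: "distinct xs" "set xs = X" by (auto simp: shortest_numbering_def)
  have X: "xs ! i \<in> X" if "i < length xs" for i using that xs by auto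
  have s: "s ! i = d (xs ! i) (xs ! Suc i)" if "Suc i < length xs" for i
    using that assms(6) by (simp add: path_spectrum_nth)
  have len: "i < length s \<longleftrightarrow> Suc i < length xs" for i using assms(6) by auto
  have label: "tree_label (representing_tree X d) = mdiam d"
    by (simp add: representing_tree_def)
  have internal: "u \<in> internal_nodes (representing_tree X d) \<longleftrightarrow> u \<in> nodes \<and> 0 < mdiam d u" for u
    by (simp add: internal_nodes_def label)
  show ?thesis
  proof
    assume L: ?distinct_labels
    show ?none_longer_between
    proof (intro allI impI; elim conjE)
      fix i j k
      assume ij: "i < j" "j < length s" "s ! i = s ! j" and k: "i < k" "k < j"
      have l: "Suc i < length xs" "Suc j < length xs" using ij len by auto
      have ne: "xs ! i \<noteq> xs ! Suc i" "xs ! j \<noteq> xs ! Suc j"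
        using l xs by (auto simp: nth_eq_iff_index_eq)
      obtain u where u: "u \<in> nodes" "xs ! i \<in> u" "mdiam d u = s ! i"
        using node_of_pair[OF assms(2) X X ne(1)] l s by (metis Suc_lessD)
      obtain v where v: "v \<in> nodes" "xs ! j \<in> v" "mdiam d v = s ! j"
        using node_of_pair[OF assms(2) X X ne(2)] l s by (metis Suc_lessD)
      have "0 < s ! i" using s[OF l(1)] ne(1) X l by simp
      then have "u \<in> internal_nodes (representing_tree X d)"
        "v \<in> internal_nodes (representing_tree X d)"
        using u v ij(3) by (simp_all add: internal)
      then have "u = v" using L u(3) v(3) ij(3) label by metis
      then have "d (xs ! i) (xs ! j) \<le> s ! i"
        using node_is_ball[OF assms(2) u(1,2)] u(3) v(2) by auto
      moreover have "s ! k \<le> d (xs ! i) (xs ! j)"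
        using step_le_dist[OF short, of i k j] k l s[of k] by simp
      ultimately show "s ! k \<le> s ! i" by simp
    qed
  next
    assume U: ?none_longer_between
    \<comment> \<open>Without a longer step in between, the two steps of length \<open>D\<close> start in the same
      ball of radius \<open>D\<close>.\<close>
    have eq: "u = v"
      if "u \<in> nodes" "v \<in> nodes" "mdiam d u = D" "mdiam d v = D" "0 < D"
        and t: "xs ! t \<in> u" "xs ! t' \<in> v" "t \<le> t'" "Suc t' < length xs" "s ! t = D" "s ! t' = D"
      for u v t t' D
    proof -
      have le: "s ! k \<le> D" if "t \<le> k" "k < t'" for k
      proof (cases "t = k")
        case True
        then show ?thesis using t by simp
      next
        case False
        then show ?thesis using U[rule_format, of t t' k] that t len by auto
      qed
      have "d (xs ! t) (xs ! t') \<le> D"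
      proof (rule dist_le_if_steps_le)
        fix k assume "t \<le> k" "k < t'"
        then show "d (xs ! k) (xs ! Suc k) \<le> D" using le[of k] s[of k] t(4) by linarith
      qed (use xs t(3,4) \<open>0 < D\<close> in simp_all)
      then have "xs ! t' \<in> u"
        using node_is_ball[OF assms(2) \<open>u \<in> nodes\<close> t(1)] \<open>mdiam d u = D\<close> X t(4) by simp
      then have "y \<in> u \<longleftrightarrow> y \<in> v" for y
        using node_is_ball[OF assms(2) \<open>u \<in> nodes\<close>, of "xs ! t'" y]
          node_is_ball[OF assms(2) \<open>v \<in> nodes\<close> t(2), of y] that(3,4) by simp
      then show "u = v" by blast
    qed
    show ?distinct_labels
    proof (intro ballI impI notI)
      fix u v
      assume "u \<in> internal_nodes (representing_tree X d)"
        and "v \<in> internal_nodes (representing_tree X d)"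
        and "u \<noteq> v"
        and "tree_label (representing_tree X d) u = tree_label (representing_tree X d) v"
      then have uv: "u \<in> nodes" "v \<in> nodes" "0 < mdiam d u" "mdiam d v = mdiam d u"
        by (auto simp: internal label)
      obtain t where t: "Suc t < length xs" "xs ! t \<in> u" "s ! t = mdiam d u"
        using node_contains_diameter_step[OF short, of u] uv s by metis
      obtain t' where t': "Suc t' < length xs" "xs ! t' \<in> v" "s ! t' = mdiam d u"
        using node_contains_diameter_step[OF short, of v] uv s by metis
      have "u = v"
      proof (cases "t \<le> t'")
        case True
        show ?thesis by (rule eq[OF uv(1,2) refl uv(4,3) t(2) t'(2) True t'(1) t(3) t'(3)])
      next
        case False
        then have "t' \<le> t" by simp
        then have "v = u" by (rule eq[OF uv(2,1,4) refl uv(3) t'(2) t(2) _ t(1) t'(3) t(3)])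
        then show ?thesis ..
      qed
      then show False using \<open>u \<noteq> v\<close> by simp
    qed
  qed
qed

end
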